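(* Let $T$ be a triangulation of a rectangular polyomino with a single domino tile. Then $T$ is word-representable if and only if $T$ is $3$-colourable.
   Context: **Word-representability.** Let $w$ be a word and let $x,y$ be two distinct letters occurring in $w$. They *alternate* in $w$ if deleting all other letters from $w$ leaves a word of the form $xyxy\cdots$ or $yxyx\cdots$ (of even or odd length). A finite simple graph $G=(V,E)$ is *word-representable* if there is a finite word $w$ over the alphabet $V$ such that, for all distinct $x,y\in V$, the letters $x$ and $y$ alternate in $w$ if and only if $xy\in E$. **Colourability.** A graph is *$3$-colourable* if its vertices can be coloured with at most $3$ colours so that adjacent vertices receive different colours. **Rectangular polyomino with a single domino tile.** Let $m,n\ge 1$ be integers and consider the $m\times n$ rectangle divided into unit squares. As a graph it has vertex set $\{0,\dots,m\}\times\{0,\dots,n\}$, and two vertices are adjacent when they are at Euclidean distance $1$ (the grid graph). A *rectangular polyomino with a single domino tile* is obtained by merging exactly one pair of unit squares sharing a side into one $1\times 2$ or $2\times 1$ tile (the *domino tile* ). That is, the edge common to the two squares is deleted, and all vertices are kept. The tiles are then the remaining unit squares (each bounded by a $4$-cycle) and the one domino tile, whose boundary is a $6$-cycle that includes the midpoints of its two long sides. **Triangulation.** A *triangulation* of such a graph is obtained by adding edges inside tiles as follows. - In each unit square tile, one of its two diagonals is added. - The domino tile is divided into four triangles in one of two ways. For a horizontal domino with vertices $(a,b),(a+1,b),(a+2,b),(a,b+1),(a+1,b+1),(a+2,b+1)$, one adds either the three edges $(a,b)(a+1,b+1)$, $(a,b)(a+2,b+1)$, $(a+1,b)(a+2,b+1)$,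 or the three edges $(a,b+1)(a+1,b)$, $(a,b+1)(a+2,b)$, $(a+1,b+1)(a+2,b)$. For a vertical domino the two ways are obtained from these by exchanging the two coordinates. (The edge joining the midpoints of the two long sides of the domino is not present.) The choices in different tiles are independent and arbitrary. *)

theory Defs
  imports "HOL-Analysis.Product_Vector"
begin

text \<open>A graph is given by a vertex set and a set of edges, an edge being the set of its two ends.\<close>

definition simple_graph :: "'a set \<Rightarrow> 'a set set \<Rightarrow> bool" where
  "simple_graph V E \<longleftrightarrow> finite V \<and> (\<forall>e\<in>E. e \<subseteq> V \<and> card e = 2)"

fun alternating_word :: "'a \<Rightarrow> 'a \<Rightarrow> nat \<Rightarrow> 'a list" where
  "alternating_word x y 0 = []"
| "alternating_word x y (Suc k) = x # alternating_word y x k"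

text \<open>Only letters that occur in the word can alternate in it.\<close>

definition alternate :: "'a \<Rightarrow> 'a \<Rightarrow> 'a list \<Rightarrow> bool" where
  "alternate x y w \<longleftrightarrow> x \<in> set w \<and> y \<in> set w \<and> x \<noteq> y \<and>
     (\<exists>k. filter (\<lambda>z. z = x \<or> z = y) w = alternating_word x y k
        \<or> filter (\<lambda>z. z = x \<or> z = y) w = alternating_word y x k)"

definition word_representable :: "'a set \<Rightarrow> 'a set set \<Rightarrow> bool" where
  "word_representable V E \<longleftrightarrow>
     (\<exists>w. set w \<subseteq> V \<and> (\<forall>x\<in>V. \<forall>y\<in>V. x \<noteq> y \<longrightarrow> (alternate x y w \<longleftrightarrow> {x, y} \<in> E)))"

definition colourable :: "nat \<Rightarrow> 'a set \<Rightarrow> 'a set set \<Rightarrow> bool" where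
  "colourable k V E \<longleftrightarrow>
     (\<exists>c :: 'a \<Rightarrow> nat. (\<forall>v\<in>V. c v < k) \<and> (\<forall>x\<in>V. \<forall>y\<in>V. {x, y} \<in> E \<longrightarrow> c x \<noteq> c y))"

type_synonym point = "nat \<times> nat"

definition grid_vertices :: "nat \<Rightarrow> nat \<Rightarrow> point set" where
  "grid_vertices m n = {0..m} \<times> {0..n}"

text \<open>The metric on \<^typ>\<open>real \<times> real\<close> is the Euclidean one.\<close>

definition grid_edges :: "nat \<Rightarrow> nat \<Rightarrow> point set set" where
  "grid_edges m n = {{p, q} | p q. p \<in> grid_vertices m n \<and> q \<in> grid_vertices m n \<and>
     dist (real (fst p), real (snd p)) (real (fst q), real (snd q)) = 1}"

text \<open>A unit square is named by its lower left corner.\<close>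

definition unit_squares :: "nat \<Rightarrow> nat \<Rightarrow> point set" where
  "unit_squares m n = {0..<m} \<times> {0..<n}"

fun diagonals :: "point \<Rightarrow> point set set" where
  "diagonals (i, j) = {{(i, j), (i + 1, j + 1)}, {(i + 1, j), (i, j + 1)}}"

definition horizontal_domino_triangulations :: "nat \<Rightarrow> nat \<Rightarrow> point set set set" where
  "horizontal_domino_triangulations a b =
     {{{(a, b), (a + 1, b + 1)}, {(a, b), (a + 2, b + 1)}, {(a + 1, b), (a + 2, b + 1)}},
      {{(a, b + 1), (a + 1, b)}, {(a, b + 1), (a + 2, b)}, {(a + 1, b + 1), (a + 2, b)}}}"

definition vertical_domino_triangulations :: "nat \<Rightarrow> nat \<Rightarrow> point set set set" where
  "vertical_domino_triangulations a b =
     (\<lambda>F. (\<lambda>e. prod.swap ` e) ` F) ` horizontal_domino_triangulations b a"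

text \<open>
  \<open>domino_tile m n D e Fs\<close>: within the \<open>m \<times> n\<close> rectangle, \<open>D\<close> is a set of two unit
  squares whose common side is \<open>e\<close>, and \<open>Fs\<close> consists of the two edge sets that may be added
  inside the domino obtained by merging them.
\<close>

inductive domino_tile ::
  "nat \<Rightarrow> nat \<Rightarrow> point set \<Rightarrow> point set \<Rightarrow> point set set set \<Rightarrow> bool" for m n where
  horizontal: "(a, b) \<in> unit_squares m n \<Longrightarrow> (a + 1, b) \<in> unit_squares m n \<Longrightarrow>
     domino_tile m n {(a, b), (a + 1, b)} {(a + 1, b), (a + 1, b + 1)}
       (horizontal_domino_triangulations a b)"
| vertical: "(a, b) \<in> unit_squares m n \<Longrightarrow> (a, b + 1) \<in> unit_squares m n \<Longrightarrow>
     domino_tile m n {(a, b), (a, b + 1)} {(a, b + 1), (a + 1, b + 1)}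
       (vertical_domino_triangulations a b)"

text \<open>
  \<open>E\<close> is the edge set of a triangulation, on the vertices \<open>grid_vertices m n\<close>, of the
  \<open>m \<times> n\<close> rectangular polyomino with a single domino tile; \<open>d\<close> selects the diagonals of the
  remaining unit squares and \<open>F\<close> the edges inside the domino.
\<close>

definition single_domino_triangulation :: "nat \<Rightarrow> nat \<Rightarrow> point set set \<Rightarrow> bool" where
  "single_domino_triangulation m n E \<longleftrightarrow>
     (\<exists>D e Fs F d. domino_tile m n D e Fs \<and> F \<in> Fs \<and>
        (\<forall>s \<in> unit_squares m n - D. d s \<in> diagonals s) \<and>
        E = (grid_edges m n - {e}) \<union> d ` (unit_squares m n - D) \<union> F)"

lemma simple_graph_single_domino_triangulation:
  assumes "single_domino_triangulation m n E"
  shows "simple_graph (grid_vertices m n) E"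
proof -
  obtain D e Fs F d where D: "domino_tile m n D e Fs" and F: "F \<in> Fs"
    and d: "\<And>s. s \<in> unit_squares m n - D \<Longrightarrow> d s \<in> diagonals s"
    and E: "E = (grid_edges m n - {e}) \<union> d ` (unit_squares m n - D) \<union> F"
    using assms unfolding single_domino_triangulation_def by blast
  have 1: "f \<subseteq> grid_vertices m n \<and> card f = 2" if "f \<in> grid_edges m n" for f
    using that unfolding grid_edges_def by (auto simp: card_insert_if)
  have 2: "d s \<subseteq> grid_vertices m n \<and> card (d s) = 2" if s: "s \<in> unit_squares m n - D" for s
  proof -
    have "\<forall>f\<in>diagonals s. f \<subseteq> grid_vertices m n \<and> card f = 2" if "s \<in> unit_squares m n"
      using that by (cases s) (simp add: grid_vertices_def unit_squares_def)
    then show ?thesis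
      using d[OF s] s by blast
  qed
  have 3: "\<forall>f\<in>F. f \<subseteq> grid_vertices m n \<and> card f = 2"
    using D
  proof cases
    case (horizontal a b)
    have "\<forall>F\<in>horizontal_domino_triangulations a b. \<forall>f\<in>F. f \<subseteq> grid_vertices m n \<and> card f = 2"
      using horizontal(4,5)
      by (simp add: horizontal_domino_triangulations_def grid_vertices_def unit_squares_def)
    then show ?thesis
      using F horizontal(3) by blast
  next
    case (vertical a b)
    have "\<forall>F\<in>vertical_domino_triangulations a b. \<forall>f\<in>F. f \<subseteq> grid_vertices m n \<and> card f = 2"
      using vertical(4,5)
      by (simp add: vertical_domino_triangulations_def horizontal_domino_triangulations_def
          grid_vertices_def unit_squares_def)
    then show ?thesis
      using F vertical(3) by blast
  qed
  have "finite (grid_vertices m n)"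
    by (simp add: grid_vertices_def)
  moreover have "\<forall>f\<in>E. f \<subseteq> grid_vertices m n \<and> card f = 2"
    unfolding E using 1 2 3 by blast
  ultimately show ?thesis
    unfolding simple_graph_def by blast
qed

end

theory Submission
  imports Defs
begin

text \<open>
  A word representing a graph properly coloured by 0, 1, 2 is a concatenation of blocks, each
  containing all letters equally often, in which the ends of every edge alternate with the end of
  smaller colour first, while for every non-edge some block destroys the alternation.

  Conversely, in a word-representable graph the neighbours of a vertex \<open>v\<close> form a comparability
  graph: the difference between the numbers of occurrences of a neighbour \<open>x\<close> and of \<open>v\<close> in a prefix
  takes two consecutive values, hence encodes a set of prefixes, and two neighbours alternate iff their
  sets are comparable. So the link of an interior vertex, an induced cycle, has even length. In terms
  of the directions of the diagonals this is a parity condition on the four squares around the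
  vertex, and the parity conditions together allow one to define a 3-colouring by prescribing its
  increments modulo 3 along rows and columns.
\<close>

section \<open>Words for 3-colourable graphs\<close>

text \<open>An even prefix uses up complete pairs \<open>x y\<close>, so the remainder starts with
  \<open>x\<close> again instead of exchanging the two letters.\<close>

lemma alternating_word_append:
  assumes "xs @ ys = alternating_word x y k" "even (length xs)"
  shows "\<exists>k l. xs = alternating_word x y k \<and> ys = alternating_word x y l"
  using assms
proof (induction xs arbitrary: k rule: induct_list012)
  case 1
  then show ?case by (metis alternating_word.simps(1) append_Nil)
next
  case (2 u)
  then show ?case by simp
next
  case (3 u u' zs)
  then obtain k' where k: "k = Suc (Suc k')"
    by (metis One_nat_def alternating_word.simps append_Cons list.distinct(1) list.inject not0_implies_Suc)
  with 3 have "zs @ ys = alternating_word x y k'" "even (length zs)" "u = x" "u' = y"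
    by auto
  with 3(1) obtain k l where "zs = alternating_word x y k" "ys = alternating_word x y l"
    by blast
  then have "u # u' # zs = alternating_word x y (Suc (Suc k))"
    using \<open>u = x\<close> \<open>u' = y\<close> by simp
  then show ?case
    using \<open>ys = alternating_word x y l\<close> by blast
qed

text \<open>Since all earlier blocks have even length, every block starts with the same letter as
  the whole word. One block with another pattern therefore destroys the alternation.\<close>

lemma alternating_word_concat:
  assumes "concat bs = alternating_word x y k" "\<forall>b\<in>set bs. even (length b)" "b \<in> set bs"
  shows "\<exists>k. b = alternating_word x y k"
  using assms
proof (induction bs arbitrary: k)
  case (Cons b' bs)
  have "\<exists>k l. b' = alternating_word x y k \<and> concat bs = alternating_word x y l"
    using alternating_word_append[of b' "concat bs"] Cons.prems by simp
  then show ?case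
    using Cons by auto
qed simp

lemma concat_alternating_pairs:
  assumes "\<forall>b\<in>set bs. b = [x, y] \<or> b = [x, y, x, y]"
  shows "\<exists>k. concat bs = alternating_word x y k"
  using assms
proof (induction bs)
  case Nil
  then show ?case by (metis alternating_word.simps(1) concat.simps(1))
next
  case (Cons b bs)
  then obtain k where "concat bs = alternating_word x y k" by auto
  then have "concat (b # bs) = alternating_word x y (Suc (Suc k)) \<or>
      concat (b # bs) = alternating_word x y (Suc (Suc (Suc (Suc k))))"
    using Cons.prems by auto
  then show ?case by blast
qed

lemma filter_two_distinct:
  assumes "distinct l" "\<not> (x \<in> set l \<and> y \<in> set l)"
  shows "filter (\<lambda>u. u = x \<or> u = y) l =
    (if x \<in> set l then [x] else []) @ (if y \<in> set l then [y] else [])"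
  using assms by (induction l) (auto simp: filter_empty_conv)

lemma filter_two_distinct_both:
  assumes "distinct l" "x \<in> set l" "y \<in> set l" "x \<noteq> y"
  shows "filter (\<lambda>u. u = x \<or> u = y) l \<in> {[x, y], [y, x]}"
  using assms
proof (induction l)
  case (Cons a l)
  show ?case
  proof (cases "a = x \<or> a = y")
    case True
    then show ?thesis
      using Cons.prems filter_two_distinct[of l x y] by auto
  next
    case False
    then show ?thesis
      using Cons by auto
  qed
qed simp

lemma alternate_commute: "alternate x y w \<longleftrightarrow> alternate y x w"
  unfolding alternate_def by (simp add: disj_commute conj_commute) blast

lemma colourable_3_imp_word_representable:
  assumes G: "simple_graph V E" and col: "colourable 3 V E"
  shows "word_representable V E"
proof -
  obtain c :: "'a \<Rightarrow> nat" where c3: "\<And>v. v \<in> V \<Longrightarrow> c v < 3"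
    and cE: "\<And>x y. x \<in> V \<Longrightarrow> y \<in> V \<Longrightarrow> {x, y} \<in> E \<Longrightarrow> c x \<noteq> c y"
    using col unfolding colourable_def by blast
  have finV: "finite V"
    using G by (simp add: simple_graph_def)
  have "\<exists>l. set l = {v \<in> V. c v = k} \<and> distinct l" for k
    using finite_distinct_list[of "{v \<in> V. c v = k}"] finV by auto
  then obtain L where L: "\<And>k. set (L k) = {v \<in> V. c v = k}" "\<And>k. distinct (L k)"
    by metis
  define A B C where "A = L 0" and "B = L 1" and "C = L 2"
  have sets: "set A = {v \<in> V. c v = 0}" "set B = {v \<in> V. c v = 1}" "set C = {v \<in> V. c v = 2}"
    and dist: "distinct A" "distinct B" "distinct C"
    unfolding A_def B_def C_def using L by auto
  have V_cases: "v \<in> V \<Longrightarrow> c v = 0 \<or> c v = 1 \<or> c v = 2" for v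
    using c3[of v] by linarith
  define F where "F x y w = filter (\<lambda>u. u = x \<or> u = y) w" for x y :: 'a and w
  have F_append: "F x y (u @ w) = F x y u @ F x y w"
    and F_Cons: "F x y (z # w) = (if z = x \<or> z = y then z # F x y w else F x y w)"
    and F_Nil: "F x y [] = []" for x y z u w
    by (auto simp: F_def)
  have F_dist: "distinct l \<Longrightarrow> \<not> (x \<in> set l \<and> y \<in> set l) \<Longrightarrow>
     F x y l = (if x \<in> set l then [x] else []) @ (if y \<in> set l then [y] else [])" for l x y
    unfolding F_def by (rule filter_two_distinct)
  have F_both: "distinct l \<Longrightarrow> x \<in> set l \<Longrightarrow> y \<in> set l \<Longrightarrow> x \<noteq> y \<Longrightarrow> F x y l = [x, y] \<or> F x y l = [y, x]"
    for l x y
    using filter_two_distinct_both[of l x y] unfolding F_def by simp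
  \<comment> \<open>The two shapes belong to blocks with one and with two copies of each letter.
    Equal counts give every restriction to two letters an even length, so that an alternating word
    can be cut at block boundaries.\<close>
  define good where "good b \<longleftrightarrow> set b \<subseteq> V \<and>
      (\<forall>x\<in>V. \<forall>y\<in>V. c x < c y \<longrightarrow> {x, y} \<in> E \<longrightarrow> F x y b = [x, y] \<or> F x y b = [x, y, x, y]) \<and>
      (\<forall>x\<in>V. \<forall>y\<in>V. count_list b x = count_list b y)" for b
  have len_F: "x \<noteq> y \<Longrightarrow> length (F x y b) = count_list b x + count_list b y" for x y b
    by (induction b) (auto simp: F_Cons F_Nil)
  have good_even: "even (length (F x y b))" if "good b" "x \<in> V" "y \<in> V" "x \<noteq> y" for b x y
    using that len_F[of x y b] unfolding good_def by (metis mult_2 dvd_triv_left)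
  have count: "distinct l \<Longrightarrow> count_list l x = (if x \<in> set l then 1 else 0)" for l :: "'a list" and x
    by (induction l) auto
  have goodI: "good b"
    if b: "set b \<subseteq> V" "\<And>u. u \<in> V \<Longrightarrow> count_list b u = k"
      and e01: "\<And>x y. \<lbrakk>x \<in> V; y \<in> V; {x, y} \<in> E; c x = 0; c y = 1; x \<noteq> y\<rbrakk> \<Longrightarrow>
        F x y b = [x, y] \<or> F x y b = [x, y, x, y]"
      and e12: "\<And>x y. \<lbrakk>x \<in> V; y \<in> V; {x, y} \<in> E; c x = 1; c y = 2; x \<noteq> y\<rbrakk> \<Longrightarrow>
        F x y b = [x, y] \<or> F x y b = [x, y, x, y]"
      and e02: "\<And>x y. \<lbrakk>x \<in> V; y \<in> V; {x, y} \<in> E; c x = 0; c y = 2; x \<noteq> y\<rbrakk> \<Longrightarrow>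
        F x y b = [x, y] \<or> F x y b = [x, y, x, y]"
    for b k
  proof -
    have "F x y b = [x, y] \<or> F x y b = [x, y, x, y]"
      if xy: "x \<in> V" "y \<in> V" "c x < c y" "{x, y} \<in> E" for x y
    proof -
      consider "c x = 0" "c y = 1" | "c x = 1" "c y = 2" | "c x = 0" "c y = 2"
        using xy V_cases[of x] V_cases[of y] by linarith
      moreover have "x \<noteq> y" using xy by auto
      ultimately show ?thesis
        using xy e01[of x y] e12[of x y] e02[of x y] by cases auto
    qed
    then show ?thesis
      using b unfolding good_def by simp
  qed
  note F_simps = F_append F_Cons F_Nil F_dist dist distinct_removeAll sets
  have base: "good (A @ B @ C)"
  proof (rule goodI[of _ 1])
    show "count_list (A @ B @ C) u = 1" if "u \<in> V" for u
      using V_cases[OF that] that by (elim disjE) (auto simp: count dist distinct_removeAll sets)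
  qed (auto simp: F_simps)
  \<comment> \<open>Reversing within each class keeps the order of the colours but exchanges any two
    letters of equal colour.\<close>
  have rbase: "good (rev A @ rev B @ rev C)"
  proof (rule goodI[of _ 1])
    show "count_list (rev A @ rev B @ rev C) u = 1" if "u \<in> V" for u
      using V_cases[OF that] that by (elim disjE) (auto simp: count dist distinct_removeAll sets)
  qed (auto simp: F_simps)
  \<comment> \<open>Moving \<open>x\<close> to the end of its class and \<open>y\<close> to the
    front of the next one lets them change places without reversing any other pair of different
    colours.\<close>
  have ab: "good (removeAll x A @ [y, x] @ removeAll y B @ C)"
    if asm: "x \<in> V" "y \<in> V" "{x, y} \<notin> E" "c x = 0" "c y = 1" for x y
  proof (rule goodI[of _ 1])
    show "count_list (removeAll x A @ [y, x] @ removeAll y B @ C) u = 1" if "u \<in> V" for u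
      using V_cases[OF that] that asm by (elim disjE) (auto simp: count dist distinct_removeAll sets)
  qed (use asm in \<open>auto simp: F_simps\<close>)
  have bc: "good (A @ removeAll y B @ [z, y] @ removeAll z C)"
    if asm: "y \<in> V" "z \<in> V" "{y, z} \<notin> E" "c y = 1" "c z = 2" for y z
  proof (rule goodI[of _ 1])
    show "count_list (A @ removeAll y B @ [z, y] @ removeAll z C) u = 1" if "u \<in> V" for u
      using V_cases[OF that] that asm by (elim disjE) (auto simp: count dist distinct_removeAll sets)
  qed (use asm in \<open>auto simp: F_simps\<close>)
  txt \<open>Two copies of every letter, with both copies of \<open>x\<close> before those of \<open>z\<close>, as no ordering of
    single copies separates \<open>x\<close> from \<open>z\<close> when they have a common neighbour in \<open>B\<close>.\<close>
  have ac: "good (removeAll x A @ [x] @ B @ removeAll z C @ [x, z] @ removeAll x A @ B @ [z] @ removeAll z C)"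
    if asm: "x \<in> V" "z \<in> V" "{x, z} \<notin> E" "c x = 0" "c z = 2" for x z
  proof (rule goodI[of _ 2])
    show "count_list (removeAll x A @ [x] @ B @ removeAll z C @ [x, z] @ removeAll x A @ B @ [z] @ removeAll z C) u = 2"
      if "u \<in> V" for u
      using V_cases[OF that] that asm by (elim disjE) (auto simp: count dist distinct_removeAll sets)
  qed (use asm in \<open>auto simp: F_simps\<close>)
  \<comment> \<open>The pattern \<open>[y, x]\<close> conflicts with the pattern
    \<open>[x, y]\<close> of the base block, and \<open>[x, x, y, y]\<close> does not alternate at
    all.\<close>
  have "\<exists>b. good b \<and> (F x y b = [y, x] \<or> F x y b = [x, x, y, y])"
    if xy: "x \<in> V" "y \<in> V" "{x, y} \<notin> E" "c x < c y" for x y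
  proof -
    consider "c x = 0" "c y = 1" | "c x = 1" "c y = 2" | "c x = 0" "c y = 2"
      using xy V_cases[of x] V_cases[of y] by linarith
    then show ?thesis
    proof cases
      case 1
      have "x \<noteq> y" using 1 by auto
      then have "F x y (removeAll x A @ [y, x] @ removeAll y B @ C) = [y, x]"
        using xy 1 by (auto simp: F_simps)
      with ab[OF xy(1-3) 1] show ?thesis by blast
    next
      case 2
      have "x \<noteq> y" using 2 by auto
      then have "F x y (A @ removeAll x B @ [y, x] @ removeAll y C) = [y, x]"
        using xy 2 by (auto simp: F_simps)
      with bc[OF xy(1-3) 2] show ?thesis by blast
    next
      case 3
      have "x \<noteq> y" using 3 by auto
      then have "F x y (removeAll x A @ [x] @ B @ removeAll y C @ [x, y] @ removeAll x A @ B @ [y] @ removeAll y C) = [x, x, y, y]"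
        using xy 3 by (auto simp: F_simps)
      with ac[OF xy(1-3) 3] show ?thesis by blast
    qed
  qed
  then obtain K where K: "\<And>x y. x \<in> V \<Longrightarrow> y \<in> V \<Longrightarrow> {x, y} \<notin> E \<Longrightarrow> c x < c y \<Longrightarrow>
      good (K x y) \<and> (F x y (K x y) = [y, x] \<or> F x y (K x y) = [x, x, y, y])"
    by metis
  obtain ps where ps: "set ps = {(x, y) \<in> V \<times> V. {x, y} \<notin> E \<and> c x < c y}"
    using finite_list[OF finite_subset[of "{(x, y) \<in> V \<times> V. {x, y} \<notin> E \<and> c x < c y}" "V \<times> V"]] finV
    by auto
  \<comment> \<open>The first two blocks separate letters of equal colour; each further block spoils
    one non-edge between different colours.\<close>
  define bs where "bs = (A @ B @ C) # (rev A @ rev B @ rev C) # map (\<lambda>(x, y). K x y) ps"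
  define w where "w = concat bs"
  have good_bs: "\<forall>b\<in>set bs. good b"
    unfolding bs_def using base rbase K ps by auto
  have Fw: "F x y w = concat (map (F x y) bs)" for x y
    unfolding w_def F_def by (simp add: filter_concat)
  have set_w: "set w = V"
  proof
    show "set w \<subseteq> V"
      unfolding w_def using good_bs by (auto simp: good_def)
    show "V \<subseteq> set w"
      by (auto simp: w_def bs_def sets dest: V_cases)
  qed
  have edge: "alternate x y w" if "x \<in> V" "y \<in> V" "c x < c y" "{x, y} \<in> E" for x y
  proof -
    have "\<exists>k. F x y w = alternating_word x y k"
      unfolding Fw by (rule concat_alternating_pairs) (use good_bs that in \<open>auto simp: good_def\<close>)
    then show ?thesis
      using that set_w unfolding alternate_def F_def by auto
  qed
  have split_w: "\<exists>k. F x y b = alternating_word u v k"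
    if "F x y w = alternating_word u v k" "x \<in> V" "y \<in> V" "x \<noteq> y" "b \<in> set bs" for x y u v k b
    by (rule alternating_word_concat[of "map (F x y) bs" u v k])
      (use that Fw good_bs good_even in auto)
  have start: "u = x \<and> v = y" if "[x, y] = alternating_word u v k" for x y u v :: 'a and k
    using that by (cases k; cases "k - 1") auto
  have start2: "x = y" if "[x, x, y, y] = alternating_word u v k" for x y u v :: 'a and k
    using that by (cases k; cases "k - 1"; cases "k - 2"; cases "k - 3") auto
  have nonedge: "\<not> alternate x y w" if "x \<in> V" "y \<in> V" "c x < c y" "{x, y} \<notin> E" for x y
  proof
    assume "alternate x y w"
    then obtain u v k where uv: "F x y w = alternating_word u v k"
      unfolding alternate_def F_def by blast
    have "x \<noteq> y" using that by auto
    note s = split_w[OF uv that(1,2) \<open>x \<noteq> y\<close>]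
    have "F x y (A @ B @ C) = [x, y]"
      using that V_cases[of x] V_cases[of y] by (auto simp: F_simps)
    moreover have "A @ B @ C \<in> set bs" "K x y \<in> set bs"
      using that ps by (force simp: bs_def)+
    ultimately show False
      using s[of "A @ B @ C"] s[of "K x y"] K[OF that(1,2,4,3)] start start2 \<open>x \<noteq> y\<close> by metis
  qed
  have same: "\<not> alternate x y w" if xy: "x \<in> V" "y \<in> V" "c x = c y" "x \<noteq> y" for x y
  proof
    assume "alternate x y w"
    then obtain u v k where uv: "F x y w = alternating_word u v k"
      unfolding alternate_def F_def by blast
    note s = split_w[OF uv xy(1,2,4)]
    have rev_F: "F x y (rev l) = rev (F x y l)" for l
      by (simp add: F_def rev_filter)
    \<comment> \<open>Both orders of \<open>x\<close> and \<open>y\<close> occur, one in the base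
      block and one in its classwise reversal, but all blocks of an alternating word start with the
      same letter.\<close>
    obtain b b' where b: "b \<in> set bs" "b' \<in> set bs" "F x y b' = rev (F x y b)"
      "F x y b = [x, y] \<or> F x y b = [y, x]"
    proof (rule that)
      show "A @ B @ C \<in> set bs" "rev A @ rev B @ rev C \<in> set bs"
        by (auto simp: bs_def)
      show "F x y (rev A @ rev B @ rev C) = rev (F x y (A @ B @ C))"
        using xy V_cases[of x] by (auto simp: F_append F_dist dist sets rev_F)
      show "F x y (A @ B @ C) = [x, y] \<or> F x y (A @ B @ C) = [y, x]"
        using xy V_cases[of x] F_both[of A x y] F_both[of B x y] F_both[of C x y]
        by (auto simp: F_append F_dist dist sets)
    qed
    obtain k1 k2 where "F x y b = alternating_word u v k1" "F x y b' = alternating_word u v k2"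
      using s b by meson
    then show False
      using b(3,4) start xy(4) by (metis rev.simps append.simps)
  qed
  have "alternate x y w \<longleftrightarrow> {x, y} \<in> E" if "x \<in> V" "y \<in> V" "x \<noteq> y" for x y
  proof (cases "c x" "c y" rule: linorder_cases)
    case less
    then show ?thesis using edge nonedge that by blast
  next
    case equal
    then show ?thesis using same cE that by blast
  next
    case greater
    then show ?thesis using edge[of y x] nonedge[of y x] that
      by (metis alternate_commute insert_commute)
  qed
  then show ?thesis
    unfolding word_representable_def using set_w by blast
qed

section \<open>Neighbourhoods in word-representable graphs\<close>

text \<open>Alternation starting with \<open>x\<close> means that \<open>x\<close> is always zero or
  one occurrence ahead. In the induction a leading \<open>x\<close> is removed and the letters
  exchange roles.\<close>

lemma exists_alternating_word_iff:
  assumes "x \<noteq> y"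
  shows "(\<exists>k. filter (\<lambda>z. z = x \<or> z = y) w = alternating_word x y k) \<longleftrightarrow>
    (\<forall>i. count_list (take i w) y \<le> count_list (take i w) x \<and>
         count_list (take i w) x \<le> Suc (count_list (take i w) y))"
  using assms
proof (induction w arbitrary: x y)
  case Nil
  have "[] = alternating_word x y 0" by simp
  then show ?case by (auto intro!: exI[of _ "0::nat"])
next
  case (Cons z w)
  have all_take: "(\<forall>i. P (take i (z # w))) \<longleftrightarrow> P [] \<and> (\<forall>i. P (z # take i w))" for P
    by (metis take0 take_Suc_Cons not0_implies_Suc)
  note all_take = all_take[of "\<lambda>l. count_list l y \<le> count_list l x \<and> count_list l x \<le> Suc (count_list l y)"]
  have alt_Cons: "(\<exists>k. u # l = alternating_word x' y' k) \<longleftrightarrow> u = x' \<and> (\<exists>k. l = alternating_word y' x' k)"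
    for u x' y' :: 'a and l
  proof
    assume "\<exists>k. u # l = alternating_word x' y' k"
    then obtain k where k: "u # l = alternating_word x' y' k" ..
    then show "u = x' \<and> (\<exists>k. l = alternating_word y' x' k)"
      by (cases k) auto
  next
    assume "u = x' \<and> (\<exists>k. l = alternating_word y' x' k)"
    then show "\<exists>k. u # l = alternating_word x' y' k"
      by (metis alternating_word.simps(2))
  qed
  consider "z = x" | "z = y" | "z \<noteq> x" "z \<noteq> y" by blast
  then show ?case
  proof cases
    case 1
    have "filter (\<lambda>z. z = x \<or> z = y) w = filter (\<lambda>z. z = y \<or> z = x) w"
      by (simp add: disj_commute)
    then show ?thesis
      unfolding all_take using 1 Cons.prems Cons.IH[of y x] by (auto simp: alt_Cons)
  next
    case 2
    \<comment> \<open>The witness 0 gives the one-letter prefix, in which \<open>y\<close> is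
      already ahead of \<open>x\<close>.\<close>
    then have "\<not> (\<forall>i. count_list (z # take i w) y \<le> count_list (z # take i w) x)"
      using Cons.prems by (auto intro!: exI[of _ 0])
    then show ?thesis
      unfolding all_take using 2 Cons.prems by (auto simp: alt_Cons)
  next
    case 3
    then show ?thesis
      unfolding all_take using Cons by auto
  qed
qed

text \<open>The empty prefix has difference 0, so \<open>d\<close> is 0 or -1, one value for each
  possible first letter. Leaving \<open>d\<close> unspecified makes the criterion symmetric and
  suits differences of counts known only up to a constant.\<close>

lemma alternate_iff_count:
  "alternate x y w \<longleftrightarrow> x \<in> set w \<and> y \<in> set w \<and> x \<noteq> y \<and>
    (\<exists>d::int. \<forall>i. int (count_list (take i w) x) - int (count_list (take i w) y) \<in> {d, d + 1})"
proof (cases "x = y")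
  case False
  let ?c = "\<lambda>x i. int (count_list (take i w) x)"
  have "filter (\<lambda>z. z = x \<or> z = y) w = filter (\<lambda>z. z = y \<or> z = x) w"
    by (simp add: disj_commute)
  then have "(\<exists>k. filter (\<lambda>z. z = x \<or> z = y) w = alternating_word y x k) \<longleftrightarrow>
      (\<forall>i. count_list (take i w) x \<le> count_list (take i w) y \<and>
           count_list (take i w) y \<le> Suc (count_list (take i w) x))"
    using exists_alternating_word_iff[of y x w] False by simp
  also have "\<dots> \<longleftrightarrow> (\<forall>i. ?c x i - ?c y i \<in> {-1, 0})"
    by (intro all_cong1) auto
  finally have yx: "(\<exists>k. filter (\<lambda>z. z = x \<or> z = y) w = alternating_word y x k) \<longleftrightarrow>
      (\<forall>i. ?c x i - ?c y i \<in> {-1, 0})" .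
  have xy: "(\<exists>k. filter (\<lambda>z. z = x \<or> z = y) w = alternating_word x y k) \<longleftrightarrow>
      (\<forall>i. ?c x i - ?c y i \<in> {0, 1})"
    unfolding exists_alternating_word_iff[OF False] by (intro all_cong1) auto
  have "(\<exists>k. filter (\<lambda>z. z = x \<or> z = y) w = alternating_word x y k \<or>
        filter (\<lambda>z. z = x \<or> z = y) w = alternating_word y x k) \<longleftrightarrow>
      (\<forall>i. ?c x i - ?c y i \<in> {0, 1}) \<or> (\<forall>i. ?c x i - ?c y i \<in> {-1, 0})"
    unfolding ex_disj_distrib xy yx ..
  also have "\<dots> \<longleftrightarrow> (\<exists>d. \<forall>i. ?c x i - ?c y i \<in> {d, d + 1})"
  proof
    assume "\<exists>d. \<forall>i. ?c x i - ?c y i \<in> {d, d + 1}"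
    then obtain d where d: "\<And>i. ?c x i - ?c y i \<in> {d, d + 1}" by blast
    then have "d = 0 \<or> d = -1" using d[of 0] by auto
    then show "(\<forall>i. ?c x i - ?c y i \<in> {0, 1}) \<or> (\<forall>i. ?c x i - ?c y i \<in> {-1, 0})"
      using d by (metis add_0 add.left_inverse)
  next
    assume "(\<forall>i. ?c x i - ?c y i \<in> {0, 1}) \<or> (\<forall>i. ?c x i - ?c y i \<in> {-1, 0})"
    then show "\<exists>d. \<forall>i. ?c x i - ?c y i \<in> {d, d + 1}"
      by (metis add_0 add.left_inverse)
  qed
  finally show ?thesis
    using False unfolding alternate_def by blast
qed (simp add: alternate_def)

text \<open>Injective renaming of the letters preserves all prefix counts and hence alternation. It
  serves to reflect the grid.\<close>

lemma word_representable_inj_image: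
  assumes "inj f" "word_representable V E"
  shows "word_representable (f ` V) ((`) f ` E)"
proof -
  obtain w where w: "set w \<subseteq> V"
    "\<And>x y. x \<in> V \<Longrightarrow> y \<in> V \<Longrightarrow> x \<noteq> y \<Longrightarrow> alternate x y w \<longleftrightarrow> {x, y} \<in> E"
    using assms(2) unfolding word_representable_def by blast
  have "count_list (map f l) (f x) = count_list l x" for l x
    using assms(1) by (induction l) (auto simp: inj_eq)
  then have "alternate (f x) (f y) (map f w) \<longleftrightarrow> alternate x y w" for x y
    using assms(1) by (simp add: alternate_iff_count take_map inj_eq inj_image_mem_iff)
  moreover have "{f x, f y} \<in> (`) f ` E \<longleftrightarrow> {x, y} \<in> E" for x y
  proof -
    have eq: "{f x, f y} = f ` e \<longleftrightarrow> e = {x, y}" for e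
      using inj_image_eq_iff[OF assms(1), of "{x, y}" e] by auto
    show ?thesis
      unfolding image_iff eq by simp
  qed
  ultimately show ?thesis
    unfolding word_representable_def using w assms(1)
    by (intro exI[of _ "map f w"]) (auto simp: inj_eq)
qed

text \<open>Let \<open>S x\<close> collect the prefixes where the difference to \<open>v\<close>
  takes its larger value. Subtracting the differences for \<open>x\<close> and \<open>y\<close>
  leaves a constant plus the difference of two indicators; the values 1 and -1 of the latter both
  occur exactly when the sets are incomparable.\<close>

lemma neighbourhood_comparability:
  assumes wr: "word_representable V E" and v: "v \<in> V"
  obtains S :: "'a \<Rightarrow> nat set" where
    "\<And>x y. \<lbrakk>x \<in> V - {v}; y \<in> V - {v}; x \<noteq> y; {v, x} \<in> E; {v, y} \<in> E\<rbrakk> \<Longrightarrow>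
      {x, y} \<in> E \<longleftrightarrow> S x \<subseteq> S y \<or> S y \<subseteq> S x"
proof -
  obtain w where w: "\<And>x y. x \<in> V \<Longrightarrow> y \<in> V \<Longrightarrow> x \<noteq> y \<Longrightarrow> alternate x y w \<longleftrightarrow> {x, y} \<in> E"
    using wr unfolding word_representable_def by blast
  define c where "c x i = int (count_list (take i w) x)" for x i
  have "\<exists>d. \<forall>i. c x i - c v i \<in> {d, d + 1}" if "x \<in> V - {v}" "{v, x} \<in> E" for x
  proof -
    have "alternate x v w"
      using w[of x v] that v by (simp add: insert_commute)
    then show ?thesis
      unfolding alternate_iff_count c_def by blast
  qed
  then obtain d where d: "\<And>x i. x \<in> V - {v} \<Longrightarrow> {v, x} \<in> E \<Longrightarrow> c x i - c v i \<in> {d x, d x + 1}"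
    by metis
  define S where "S x = {i. c x i - c v i \<noteq> d x}" for x
  show thesis
  proof (rule that)
    fix x y
    assume xy: "x \<in> V - {v}" "y \<in> V - {v}" "x \<noteq> y" "{v, x} \<in> E" "{v, y} \<in> E"
    have mem: "x \<in> set w" "y \<in> set w"
      using w[of v x] w[of v y] xy v by (auto simp: alternate_iff_count)
    have eq: "c x i - c y i = d x - d y + (of_bool (i \<in> S x) - of_bool (i \<in> S y))" for i
      using d[OF xy(1,4), of i] d[OF xy(2,5), of i] by (auto simp: S_def)
    have "{x, y} \<in> E \<longleftrightarrow> (\<exists>e. \<forall>i. c x i - c y i \<in> {e, e + 1})"
      using w[of x y] xy mem by (simp add: alternate_iff_count c_def)
    also have "\<dots> \<longleftrightarrow> S x \<subseteq> S y \<or> S y \<subseteq> S x"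
    proof
      assume "\<exists>e. \<forall>i. c x i - c y i \<in> {e, e + 1}"
      then obtain e where e: "\<And>i. c x i - c y i \<in> {e, e + 1}" by blast
      show "S x \<subseteq> S y \<or> S y \<subseteq> S x"
      proof (rule ccontr)
        assume "\<not> (S x \<subseteq> S y \<or> S y \<subseteq> S x)"
        then obtain i j where "i \<in> S x" "i \<notin> S y" "j \<in> S y" "j \<notin> S x" by blast
        then show False
          using e[of i] e[of j] eq[of i] eq[of j] by auto
      qed
    next
      assume "S x \<subseteq> S y \<or> S y \<subseteq> S x"
      then show "\<exists>e. \<forall>i. c x i - c y i \<in> {e, e + 1}"
      proof
        assume "S x \<subseteq> S y"
        then have "\<forall>i. c x i - c y i \<in> {d x - d y - 1, d x - d y - 1 + 1}"
          using eq by (auto simp: of_bool_def)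
        then show ?thesis by blast
      next
        assume "S y \<subseteq> S x"
        then have "\<forall>i. c x i - c y i \<in> {d x - d y, d x - d y + 1}"
          using eq by (auto simp: of_bool_def)
        then show ?thesis by blast
      qed
    qed
    finally show "{x, y} \<in> E \<longleftrightarrow> S x \<subseteq> S y \<or> S y \<subseteq> S x" .
  qed
qed

text \<open>The list is read cyclically. Only vertices at cyclic distance one and two are
  constrained, which simplification can check on explicit lists.\<close>

definition link_cycle :: "'a set \<Rightarrow> 'a set set \<Rightarrow> 'a \<Rightarrow> 'a list \<Rightarrow> bool" where
  "link_cycle V E v xs \<longleftrightarrow> (\<forall>x\<in>set xs. x \<in> V \<and> x \<noteq> v \<and> {v, x} \<in> E) \<and>
     list_all2 (\<lambda>x y. x \<noteq> y \<and> {x, y} \<in> E) xs (rotate1 xs) \<and>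
     list_all2 (\<lambda>x y. x \<noteq> y \<and> {x, y} \<notin> E) xs (rotate1 (rotate1 xs))"

text \<open>
  Along the cycle the inclusions between consecutive sets must alternate in direction, since
  two in the same direction would make vertices at distance two comparable.
\<close>

lemma even_length_link_cycle:
  assumes "word_representable V E" "v \<in> V" "link_cycle V E v xs"
  shows "even (length xs)"
proof (rule ccontr)
  assume odd: "odd (length xs)"
  obtain S :: "'a \<Rightarrow> nat set" where S:
    "\<And>x y. \<lbrakk>x \<in> V - {v}; y \<in> V - {v}; x \<noteq> y; {v, x} \<in> E; {v, y} \<in> E\<rbrakk> \<Longrightarrow>
      {x, y} \<in> E \<longleftrightarrow> S x \<subseteq> S y \<or> S y \<subseteq> S x"
    using neighbourhood_comparability[OF assms(1,2)] by blast
  define k where "k = length xs"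
  have k: "k > 0" using odd by (auto simp: k_def intro: Nat.gr0I)
  define X where "X i = S (xs ! (i mod k))" for i
  have mem: "xs ! (i mod k) \<in> V - {v}" "{v, xs ! (i mod k)} \<in> E" for i
    using assms(3) k nth_mem[of "i mod k" xs] by (auto simp: link_cycle_def k_def)
  have comp1: "X i \<subseteq> X (Suc i) \<or> X (Suc i) \<subseteq> X i" for i
  proof -
    have "i mod k < k" using k by simp
    then have "xs ! (i mod k) \<noteq> xs ! (Suc i mod k) \<and> {xs ! (i mod k), xs ! (Suc i mod k)} \<in> E"
      using assms(3) by (auto simp: link_cycle_def list_all2_conv_all_nth nth_rotate1 k_def mod_Suc_eq)
    then show ?thesis
      using S[OF mem(1)[of i] mem(1)[of "Suc i"]] mem(2) by (auto simp: X_def)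
  qed
  have comp2: "\<not> X i \<subseteq> X (Suc (Suc i)) \<and> \<not> X (Suc (Suc i)) \<subseteq> X i" for i
  proof -
    have "\<forall>i<k. xs ! i \<noteq> xs ! (Suc (Suc i) mod k) \<and> {xs ! i, xs ! (Suc (Suc i) mod k)} \<notin> E"
      using assms(3) k
      by (simp add: link_cycle_def list_all2_conv_all_nth nth_rotate1 k_def mod_Suc_eq)
    moreover have "i mod k < k" "Suc (Suc (i mod k)) mod k = Suc (Suc i) mod k"
      using k by (simp, metis mod_Suc_eq)
    ultimately have "xs ! (i mod k) \<noteq> xs ! (Suc (Suc i) mod k) \<and>
        {xs ! (i mod k), xs ! (Suc (Suc i) mod k)} \<notin> E"
      by metis
    then show ?thesis
      using S[OF mem(1)[of i] mem(1)[of "Suc (Suc i)"]] mem(2) by (auto simp: X_def)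
  qed
  have flip: "X (Suc i) \<subseteq> X (Suc (Suc i)) \<longleftrightarrow> \<not> X i \<subseteq> X (Suc i)" for i
    using comp1[of i] comp1[of "Suc i"] comp2[of i] by blast
  have "X i \<subseteq> X (Suc i) \<longleftrightarrow> (X 0 \<subseteq> X 1 \<longleftrightarrow> even i)" for i
    by (induction i) (use flip in auto)
  \<comment> \<open>Indices are taken modulo \<open>k\<close>, so one full turn restores the initial
    direction of inclusion, which is possible only for even \<open>k\<close>.\<close>
  moreover have "X (i + k) = X i" for i
    by (simp add: X_def)
  from this[of 0] this[of 1] have "X k = X 0" "X (Suc k) = X 1"
    by simp_all
  ultimately have "X 0 \<subseteq> X 1 \<longleftrightarrow> (X 0 \<subseteq> X 1 \<longleftrightarrow> even k)"
    by metis
  then show False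
    using odd by (simp add: k_def)
qed

section \<open>Triangulations with a horizontal domino\<close>

text \<open>
  For a domino consisting of the squares \<open>(a, b)\<close> and \<open>(a + 1, b)\<close>: \<open>s i j\<close> states that the diagonal
  in the square \<open>(i, j)\<close> is a slash. Each triangulation of the domino adds parallel diagonals to its two
  squares, so \<open>s\<close> takes the same value at both, which also determines the long diagonal.
\<close>

definition domino_arc :: "nat \<Rightarrow> nat \<Rightarrow> nat \<Rightarrow> nat \<Rightarrow> (nat \<Rightarrow> nat \<Rightarrow> bool) \<Rightarrow> point \<Rightarrow> point \<Rightarrow> bool"
  where "domino_arc m n a b s p q \<longleftrightarrow> (case (p, q) of ((i, j), (k, l)) \<Rightarrow>
     k = i \<and> l = Suc j \<and> i \<le> m \<and> j < n \<and> \<not> (i = Suc a \<and> j = b) \<or>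
     k = Suc i \<and> l = j \<and> i < m \<and> j \<le> n \<or>
     k = Suc i \<and> l = Suc j \<and> i < m \<and> j < n \<and> s i j \<or>
     k = Suc i \<and> j = Suc l \<and> i < m \<and> l < n \<and> \<not> s i l \<or>
     i = a \<and> k = Suc (Suc a) \<and> (if s a b then j = b \<and> l = Suc b else j = Suc b \<and> l = b))"

text \<open>Arcs are oriented upwards or to the right, so each kind of edge has to be treated in one
  direction only.\<close>

definition domino_edges :: "nat \<Rightarrow> nat \<Rightarrow> nat \<Rightarrow> nat \<Rightarrow> (nat \<Rightarrow> nat \<Rightarrow> bool) \<Rightarrow> point set set" where
  "domino_edges m n a b s = {{p, q} | p q. domino_arc m n a b s p q}"

lemma domino_edges_iff:
  "{p, q} \<in> domino_edges m n a b s \<longleftrightarrow> domino_arc m n a b s p q \<or> domino_arc m n a b s q p"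
  unfolding domino_edges_def mem_Collect_eq doubleton_eq_iff by blast

text \<open>The squared distance is a sum of two integer squares, which equals 1 only as 0 + 1 or 1
  + 0.\<close>

lemma dist_grid_eq_1_iff:
  "dist (real i, real j) (real k, real l) = 1 \<longleftrightarrow>
    i = k \<and> (l = Suc j \<or> j = Suc l) \<or> j = l \<and> (k = Suc i \<or> i = Suc k)"
proof -
  have sq: "(dist (real x) (real y))\<^sup>2 = real_of_int ((int x - int y)\<^sup>2)" for x y
    by (simp add: dist_real_def)
  have "dist (real i, real j) (real k, real l) = 1 \<longleftrightarrow> (int i - int k)\<^sup>2 + (int j - int l)\<^sup>2 = 1"
    unfolding dist_Pair_Pair sq real_sqrt_eq_1_iff by (metis of_int_add of_int_eq_1_iff)
  also have "\<dots> \<longleftrightarrow> (int i - int k)\<^sup>2 = 0 \<and> (int j - int l)\<^sup>2 = 1 \<or>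
      (int i - int k)\<^sup>2 = 1 \<and> (int j - int l)\<^sup>2 = 0"
    using zero_le_power2[of "int i - int k"] zero_le_power2[of "int j - int l"] by linarith
  also have "\<dots> \<longleftrightarrow> i = k \<and> (l = Suc j \<or> j = Suc l) \<or> j = l \<and> (k = Suc i \<or> i = Suc k)"
    by (auto simp: power2_eq_1_iff)
  finally show ?thesis .
qed

lemma grid_edges_eq:
  "grid_edges m n = {{(i, j), (i, Suc j)} | i j. i \<le> m \<and> j < n} \<union>
    {{(i, j), (Suc i, j)} | i j. i < m \<and> j \<le> n}" (is "_ = ?R")
proof
  show "?R \<subseteq> grid_edges m n"
    unfolding grid_edges_def by (fastforce simp: dist_grid_eq_1_iff grid_vertices_def)
  show "grid_edges m n \<subseteq> ?R"
  proof
    fix e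
    assume "e \<in> grid_edges m n"
    then obtain i j k l where e: "e = {(i, j), (k, l)}" and bounds: "i \<le> m" "k \<le> m" "j \<le> n" "l \<le> n"
      and adj: "i = k \<and> (l = Suc j \<or> j = Suc l) \<or> j = l \<and> (k = Suc i \<or> i = Suc k)"
      unfolding grid_edges_def grid_vertices_def by (force simp: dist_grid_eq_1_iff)
    have up: "{(i, j), (i, Suc j)} \<in> ?R" if "i \<le> m" "Suc j \<le> n" for i j
      using that Suc_le_lessD by blast
    have right: "{(i, j), (Suc i, j)} \<in> ?R" if "Suc i \<le> m" "j \<le> n" for i j
      using that Suc_le_lessD by blast
    consider "k = i" "l = Suc j" | "k = i" "j = Suc l" | "l = j" "k = Suc i" | "l = j" "i = Suc k"
      using adj by blast
    then show "e \<in> ?R"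
    proof cases
      case 1
      then show ?thesis using up[of i j] bounds by (simp only: e)
    next
      case 2
      then show ?thesis using up[of i l] bounds by (simp only: e insert_commute)
    next
      case 3
      then show ?thesis using right[of i j] bounds by (simp only: e)
    next
      case 4
      then show ?thesis using right[of k j] bounds by (simp only: e insert_commute)
    qed
  qed
qed

fun slash_diagonal :: "(nat \<Rightarrow> nat \<Rightarrow> bool) \<Rightarrow> point \<Rightarrow> point set" where
  "slash_diagonal s (i, j) =
     (if s i j then {(i, j), (Suc i, Suc j)} else {(Suc i, j), (i, Suc j)})"

text \<open>This connects the arcs with the set form of a triangulation: two merged squares keep
  their own diagonals, lose their common side and gain a long diagonal.\<close>

lemma domino_edges_eq:
  "domino_edges m n a b s = (grid_edges m n - {{(Suc a, b), (Suc a, Suc b)}}) \<union>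
     slash_diagonal s ` unit_squares m n \<union>
     {if s a b then {(a, b), (Suc (Suc a), Suc b)} else {(a, Suc b), (Suc (Suc a), b)}}"
  (is "_ = ?G \<union> ?D \<union> ?L")
proof
  have incl: "{p, q} \<in> ?G \<union> ?D \<union> ?L" if arc: "domino_arc m n a b s p q" for p q
  proof -
    obtain i j k l where pq: "p = (i, j)" "q = (k, l)"
      by (metis surj_pair)
    consider (up) "k = i" "l = Suc j" "i \<le> m" "j < n" "\<not> (i = Suc a \<and> j = b)"
      | (right) "k = Suc i" "l = j" "i < m" "j \<le> n"
      | (slash) "k = Suc i" "l = Suc j" "i < m" "j < n" "s i j"
      | (backslash) "k = Suc i" "j = Suc l" "i < m" "l < n" "\<not> s i l"
      | (long) "i = a" "k = Suc (Suc a)" "if s a b then j = b \<and> l = Suc b else j = Suc b \<and> l = b"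
      using arc unfolding pq domino_arc_def by auto
    then show ?thesis
    proof cases
      case up
      then have "{p, q} \<in> ?G"
        by (auto simp: pq grid_edges_eq doubleton_eq_iff)
      then show ?thesis by blast
    next
      case right
      then have "{p, q} \<in> ?G"
        by (auto simp: pq grid_edges_eq doubleton_eq_iff)
      then show ?thesis by blast
    next
      case slash
      then have "{p, q} = slash_diagonal s (i, j)" "(i, j) \<in> unit_squares m n"
        by (auto simp: pq unit_squares_def)
      then show ?thesis by blast
    next
      case backslash
      then have "{p, q} = slash_diagonal s (i, l)" "(i, l) \<in> unit_squares m n"
        by (auto simp: pq unit_squares_def)
      then show ?thesis by blast
    next
      case long
      then have "{p, q} \<in> ?L"
        by (auto simp: pq)
      then show ?thesis by blast
    qed
  qed
  show "domino_edges m n a b s \<subseteq> ?G \<union> ?D \<union> ?L"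
  proof
    fix e
    assume "e \<in> domino_edges m n a b s"
    then obtain p q where "e = {p, q}" "domino_arc m n a b s p q"
      unfolding domino_edges_def by auto
    then show "e \<in> ?G \<union> ?D \<union> ?L"
      using incl by (simp only:)
  qed
  have "?G \<subseteq> domino_edges m n a b s"
    unfolding grid_edges_eq by (auto simp: domino_edges_iff domino_arc_def)
  moreover have "?D \<subseteq> domino_edges m n a b s"
    by (auto simp: domino_edges_iff domino_arc_def unit_squares_def)
  moreover have "?L \<subseteq> domino_edges m n a b s"
    by (simp add: domino_edges_iff domino_arc_def)
  ultimately show "?G \<union> ?D \<union> ?L \<subseteq> domino_edges m n a b s"
    by blast
qed

text \<open>The domino edges are parallel diagonals of the two squares and one long diagonal. So
  \<open>s\<close> can be read off \<open>F\<close> on these squares and off \<open>d\<close>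
  elsewhere.\<close>

lemma horizontal_domino_edges:
  assumes "Suc a < m" "b < n" and F: "F \<in> horizontal_domino_triangulations a b"
    and d: "\<And>x. x \<in> unit_squares m n - {(a, b), (Suc a, b)} \<Longrightarrow> d x \<in> diagonals x"
  obtains s where "s (Suc a) b = s a b"
    "(grid_edges m n - {{(Suc a, b), (Suc a, Suc b)}}) \<union>
       d ` (unit_squares m n - {(a, b), (Suc a, b)}) \<union> F = domino_edges m n a b s"
proof -
  let ?D = "{(a, b), (Suc a, b)}"
  let ?F1 = "{{(a, b), (Suc a, Suc b)}, {(a, b), (Suc (Suc a), Suc b)}, {(Suc a, b), (Suc (Suc a), Suc b)}}"
  let ?F2 = "{{(a, Suc b), (Suc a, b)}, {(a, Suc b), (Suc (Suc a), b)}, {(Suc a, Suc b), (Suc (Suc a), b)}}"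
  define s where "s i j \<longleftrightarrow> (if (i, j) \<in> ?D then F = ?F1 else d (i, j) = {(i, j), (Suc i, Suc j)})" for i j
  have set3: "{x, y, z} = {x, z} \<union> {y}" for x y z :: "point set"
    by auto
  have s_dom: "s (Suc a) b \<longleftrightarrow> F = ?F1" "s a b \<longleftrightarrow> F = ?F1"
    by (simp_all add: s_def)
  have "d x = slash_diagonal s x" if "x \<in> unit_squares m n - ?D" for x
    using d[OF that] that by (cases x) (auto simp: s_def)
  then have 1: "d ` (unit_squares m n - ?D) = slash_diagonal s ` (unit_squares m n - ?D)"
    by (rule image_cong[OF refl])
  have "F = ?F1 \<or> F = ?F2"
    using F by (simp add: horizontal_domino_triangulations_def)
  \<comment> \<open>This makes \<open>s\<close> false at the domino when the second triangulation is
    chosen.\<close>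
  moreover have "?F1 \<noteq> ?F2"
  proof
    assume "?F1 = ?F2"
    moreover have "{(a, b), (Suc a, Suc b)} \<in> ?F1"
      by simp
    ultimately have "{(a, b), (Suc a, Suc b)} \<in> ?F2"
      by (simp only:)
    then show False
      by (simp add: doubleton_eq_iff)
  qed
  ultimately have "F = {slash_diagonal s (a, b),
      if s a b then {(a, b), (Suc (Suc a), Suc b)} else {(a, Suc b), (Suc (Suc a), b)},
      slash_diagonal s (Suc a, b)}"
    unfolding slash_diagonal.simps s_dom by (elim disjE) (simp_all add: insert_commute del: insert_iff)
  then have 2: "F = slash_diagonal s ` ?D \<union>
     {if s a b then {(a, b), (Suc (Suc a), Suc b)} else {(a, Suc b), (Suc (Suc a), b)}}"
    by (simp only: image_insert image_empty set3)
  have "unit_squares m n = (unit_squares m n - ?D) \<union> ?D"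
    using assms(1,2) by (auto simp: unit_squares_def)
  then have 3: "slash_diagonal s ` unit_squares m n =
      slash_diagonal s ` (unit_squares m n - ?D) \<union> slash_diagonal s ` ?D"
    by (metis image_Un)
  have "(grid_edges m n - {{(Suc a, b), (Suc a, Suc b)}}) \<union> d ` (unit_squares m n - ?D) \<union> F =
      domino_edges m n a b s"
    unfolding domino_edges_eq 1 3 by (subst 2) (simp only: Un_assoc)
  with s_dom show thesis
    by (intro that[of s]) simp_all
qed

section \<open>Reflection of vertical dominoes to horizontal ones\<close>

lemma swap_grid_edges: "(`) prod.swap ` grid_edges m n = grid_edges n m"
proof -
  have sub: "(`) prod.swap ` grid_edges m n \<subseteq> grid_edges n m" for m n
    unfolding grid_edges_eq by auto
  have "grid_edges n m = (`) prod.swap ` (`) prod.swap ` grid_edges n m"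
    by (simp add: image_image)
  also have "\<dots> \<subseteq> (`) prod.swap ` grid_edges m n"
    using sub by (rule image_mono)
  finally show ?thesis
    using sub[of m n] by blast
qed

text \<open>Exchanging coordinates turns slashes into slashes and backslashes into backslashes, so
  \<open>d\<close> can be transported along the reflection and the horizontal case applies.\<close>

lemma vertical_domino_edges:
  assumes "a < m" "Suc b < n" and F: "F \<in> vertical_domino_triangulations a b"
    and d: "\<And>x. x \<in> unit_squares m n - {(a, b), (a, Suc b)} \<Longrightarrow> d x \<in> diagonals x"
  obtains s where "s (Suc b) a = s b a"
    "(`) prod.swap ` ((grid_edges m n - {{(a, Suc b), (Suc a, Suc b)}}) \<union>
       d ` (unit_squares m n - {(a, b), (a, Suc b)}) \<union> F) = domino_edges n m b a s"
proof -
  let ?T = "(`) ((`) (prod.swap :: point \<Rightarrow> point))"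
  let ?D = "{(b, a), (Suc b, a)}"
  have inj: "inj ((`) (prod.swap :: point \<Rightarrow> point))"
    by (simp add: inj_def inj_image_eq_iff)
  define d' where "d' x = prod.swap ` d (prod.swap x)" for x
  obtain F' where F': "F = ?T F'" "F' \<in> horizontal_domino_triangulations b a"
    using F by (auto simp: vertical_domino_triangulations_def)
  have TF: "?T F = F'"
    unfolding F'(1) by (simp add: image_image)
  have diag: "e \<in> diagonals x \<Longrightarrow> prod.swap ` e \<in> diagonals (prod.swap x)" for e x
    by (cases x) (auto simp: insert_commute)
  have "d' x \<in> diagonals x" if "x \<in> unit_squares n m - ?D" for x
  proof -
    have "prod.swap x \<in> unit_squares m n - {(a, b), (a, Suc b)}"
      using that by (cases x) (auto simp: unit_squares_def)
    from diag[OF d[OF this]] show ?thesis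
      by (simp add: d'_def)
  qed
  from horizontal_domino_edges[OF assms(2,1) F'(2) this]
  obtain s where s: "s (Suc b) a = s b a"
    "(grid_edges n m - {{(Suc b, a), (Suc b, Suc a)}}) \<union> d' ` (unit_squares n m - ?D) \<union> F' =
      domino_edges n m b a s"
    by blast
  have "unit_squares n m - ?D = prod.swap ` (unit_squares m n - {(a, b), (a, Suc b)})"
    by (force simp: unit_squares_def)
  then have "d' ` (unit_squares n m - ?D) = ?T (d ` (unit_squares m n - {(a, b), (a, Suc b)}))"
    by (simp add: image_image d'_def)
  moreover have "?T (grid_edges m n - {{(a, Suc b), (Suc a, Suc b)}}) =
      grid_edges n m - {{(Suc b, a), (Suc b, Suc a)}}"
    by (simp add: image_set_diff[OF inj] swap_grid_edges)
  ultimately show thesis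
    using that[of s] s by (simp add: image_Un TF)
qed

text \<open>A colouring of the image is pulled back along \<open>f\<close>.\<close>

lemma colourable_inj_image:
  fixes f :: "'a \<Rightarrow> 'b"
  assumes "colourable k (f ` V) ((`) f ` E)"
  shows "colourable k V E"
proof -
  from assms obtain c :: "'b \<Rightarrow> nat" where c: "\<forall>v\<in>f ` V. c v < k"
    "\<forall>x\<in>f ` V. \<forall>y\<in>f ` V. {x, y} \<in> (`) f ` E \<longrightarrow> c x \<noteq> c y"
    unfolding colourable_def by (elim exE conjE)
  have "c (f x) \<noteq> c (f y)" if "x \<in> V" "y \<in> V" "{x, y} \<in> E" for x y
    using bspec[OF bspec[OF c(2), of "f x"], of "f y"] that imageI[of "{x, y}" E "(`) f"] by simp
  then show ?thesis
    unfolding colourable_def using c(1) by (intro exI[of _ "c \<circ> f"]) simp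
qed

section \<open>Parity conditions and the colouring\<close>

text \<open>
  The domino imposes the same parity conditions on the vertices of its lower side as two squares with
  diagonals in the directions given by \<open>lower_slash\<close>, and on those of its upper side as two squares with
  the opposite diagonals.
\<close>

definition lower_slash :: "nat \<Rightarrow> nat \<Rightarrow> (nat \<Rightarrow> nat \<Rightarrow> bool) \<Rightarrow> nat \<Rightarrow> nat \<Rightarrow> bool" where
  "lower_slash a b s i j \<longleftrightarrow> (if j = b \<and> i \<in> {a, Suc a} then i = Suc a else s i j)"

definition upper_slash :: "nat \<Rightarrow> nat \<Rightarrow> (nat \<Rightarrow> nat \<Rightarrow> bool) \<Rightarrow> nat \<Rightarrow> nat \<Rightarrow> bool" where
  "upper_slash a b s i j \<longleftrightarrow> (if j = b \<and> i \<in> {a, Suc a} then i = a else s i j)"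

section \<open>Parity conditions at interior vertices\<close>

context
  fixes m n a b :: nat and s :: "nat \<Rightarrow> nat \<Rightarrow> bool"
  assumes wr: "word_representable (grid_vertices m n) (domino_edges m n a b s)"
    and a: "Suc a < m" and b: "b < n" and s_domino: "s (Suc a) b = s a b"
begin

lemma even_link:
  assumes "link_cycle (grid_vertices m n) (domino_edges m n a b s) (i, j) xs" "i \<le> m" "j \<le> n"
  shows "even (length xs)"
  using even_length_link_cycle[OF wr _ assms(1)] assms(2,3) by (simp add: grid_vertices_def)

lemmas link_simps = link_cycle_def domino_edges_iff domino_arc_def grid_vertices_def

text \<open>The link has the four grid neighbours and one corner for each surrounding square whose
  diagonal ends at the vertex: a slash for the lower left and upper right squares, a backslash for
  the other two. The assumption \<open>ord\<close> excludes the six vertices of the domino.\<close>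

lemma parity_away_from_domino:
  assumes ij: "Suc i < m" "Suc j < n"
    and ord: "Suc j = b \<or> j = b \<Longrightarrow> Suc i \<noteq> a \<and> i \<noteq> a \<and> i \<noteq> Suc a"
  shows "(s i j = s (Suc i) j) = (s i (Suc j) = s (Suc i) (Suc j))"
proof -
  \<comment> \<open>The link is listed clockwise from the upper neighbour.\<close>
  have "link_cycle (grid_vertices m n) (domino_edges m n a b s) (Suc i, Suc j)
     ([(Suc i, Suc (Suc j))] @ (if s (Suc i) (Suc j) then [(Suc (Suc i), Suc (Suc j))] else []) @
      [(Suc (Suc i), Suc j)] @ (if s (Suc i) j then [] else [(Suc (Suc i), j)]) @
      [(Suc i, j)] @ (if s i j then [(i, j)] else []) @
      [(i, Suc j)] @ (if s i (Suc j) then [] else [(i, Suc (Suc j))]))"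
  proof (cases "Suc j = b \<or> j = b")
    case True
    then have "Suc i \<noteq> a" "i \<noteq> a" "i \<noteq> Suc a"
      using ord by auto
    then show ?thesis
      using a b ij by (simp add: link_simps)
  next
    case False
    then show ?thesis
      using a b ij by (simp add: link_simps)
  qed
  from even_link[OF this] show ?thesis
    using ij by (simp split: if_splits)
qed

text \<open>Besides the ends of its two sides at this corner, the domino contributes zero or two
  link vertices, in parity like a square with a backslash.\<close>

lemma parity_lower_left:
  assumes "a = Suc i" "b = Suc j"
  shows "(s i j = s (Suc i) j) = (\<not> s i (Suc j))"
proof -
  have "link_cycle (grid_vertices m n) (domino_edges m n a b s) (Suc i, Suc j)
     ([(Suc i, Suc (Suc j))] @
      (if s a b then [(Suc (Suc i), Suc (Suc j)), (Suc (Suc (Suc i)), Suc (Suc j))] else []) @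
      [(Suc (Suc i), Suc j)] @ (if s (Suc i) j then [] else [(Suc (Suc i), j)]) @
      [(Suc i, j)] @ (if s i j then [(i, j)] else []) @
      [(i, Suc j)] @ (if s i (Suc j) then [] else [(i, Suc (Suc j))]))"
    using a b s_domino assms by (simp add: link_simps)
  from even_link[OF this] show ?thesis
    using assms a b by (simp split: if_splits)
qed

text \<open>There is no upper neighbour, and either triangulation puts exactly one domino vertex
  between the left and right neighbours.\<close>

lemma parity_lower_middle:
  assumes "b = Suc j"
  shows "s a j \<noteq> s (Suc a) j"
proof -
  have "link_cycle (grid_vertices m n) (domino_edges m n a b s) (Suc a, Suc j)
     ([(a, Suc j), (if s a b then Suc (Suc a) else a, Suc (Suc j)), (Suc (Suc a), Suc j)] @
      (if s (Suc a) j then [] else [(Suc (Suc a), j)]) @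
      [(Suc a, j)] @ (if s a j then [(a, j)] else []))"
    using a b s_domino assms by (simp add: link_simps)
  from even_link[OF this] show ?thesis
    using assms a b by (simp split: if_splits)
qed

text \<open>Mirror image of the lower left corner: the domino counts as a square with a
  slash.\<close>

lemma parity_lower_right:
  assumes "b = Suc j" "Suc (Suc a) < m"
  shows "(s (Suc a) j = s (Suc (Suc a)) j) = s (Suc (Suc a)) b"
proof -
  have "link_cycle (grid_vertices m n) (domino_edges m n a b s) (Suc (Suc a), Suc j)
     ([(Suc (Suc a), Suc (Suc j))] @
      (if s (Suc (Suc a)) b then [(Suc (Suc (Suc a)), Suc (Suc j))] else []) @
      [(Suc (Suc (Suc a)), Suc j)] @ (if s (Suc (Suc a)) j then [] else [(Suc (Suc (Suc a)), j)]) @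
      [(Suc (Suc a), j)] @ (if s (Suc a) j then [(Suc a, j)] else []) @
      [(Suc a, Suc j)] @ (if s a b then [] else [(a, Suc (Suc j)), (Suc a, Suc (Suc j))]))"
    using a b s_domino assms by (simp add: link_simps)
  from even_link[OF this] show ?thesis
    using assms a b by (simp split: if_splits)
qed

lemma parity_upper_left:
  assumes "a = Suc i" "Suc b < n"
  shows "s i b = (s i (Suc b) = s a (Suc b))"
proof -
  have "link_cycle (grid_vertices m n) (domino_edges m n a b s) (Suc i, Suc b)
     ([(Suc i, Suc (Suc b))] @ (if s (Suc i) (Suc b) then [(Suc (Suc i), Suc (Suc b))] else []) @
      [(Suc (Suc i), Suc b)] @ (if s a b then [] else [(Suc (Suc (Suc i)), b), (Suc (Suc i), b)]) @
      [(Suc i, b)] @ (if s i b then [(i, b)] else []) @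
      [(i, Suc b)] @ (if s i (Suc b) then [] else [(i, Suc (Suc b))]))"
    using a b s_domino assms by (simp add: link_simps)
  from even_link[OF this] show ?thesis
    using assms a b by (simp split: if_splits)
qed

lemma parity_upper_middle:
  assumes "Suc b < n"
  shows "s a (Suc b) \<noteq> s (Suc a) (Suc b)"
proof -
  have "link_cycle (grid_vertices m n) (domino_edges m n a b s) (Suc a, Suc b)
     ([(Suc a, Suc (Suc b))] @ (if s (Suc a) (Suc b) then [(Suc (Suc a), Suc (Suc b))] else []) @
      [(Suc (Suc a), Suc b), (if s a b then a else Suc (Suc a), b), (a, Suc b)] @
      (if s a (Suc b) then [] else [(a, Suc (Suc b))]))"
    using a b s_domino assms by (simp add: link_simps)
  from even_link[OF this] show ?thesis
    using assms a b by (simp split: if_splits)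
qed

lemma parity_upper_right:
  assumes "Suc b < n" "Suc (Suc a) < m"
  shows "(\<not> s (Suc (Suc a)) b) = (s (Suc a) (Suc b) = s (Suc (Suc a)) (Suc b))"
proof -
  have "link_cycle (grid_vertices m n) (domino_edges m n a b s) (Suc (Suc a), Suc b)
     ([(Suc (Suc a), Suc (Suc b))] @
      (if s (Suc (Suc a)) (Suc b) then [(Suc (Suc (Suc a)), Suc (Suc b))] else []) @
      [(Suc (Suc (Suc a)), Suc b)] @ (if s (Suc (Suc a)) b then [] else [(Suc (Suc (Suc a)), b)]) @
      [(Suc (Suc a), b)] @ (if s a b then [(Suc a, b), (a, b)] else []) @
      [(Suc a, Suc b)] @ (if s (Suc a) (Suc b) then [] else [(Suc a, Suc (Suc b))]))"
    using a b s_domino assms by (simp add: link_simps)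
  from even_link[OF this] show ?thesis
    using assms a b by (simp split: if_splits)
qed

text \<open>The squares below the vertex are seen from above, hence \<open>upper_slash\<close>;
  those above it are seen from below, hence \<open>lower_slash\<close>. The case distinction runs
  through the six vertices of the domino and all others.\<close>

lemma parity:
  assumes "Suc i < m" "Suc j < n"
  shows "(upper_slash a b s i j = upper_slash a b s (Suc i) j) =
    (lower_slash a b s i (Suc j) = lower_slash a b s (Suc i) (Suc j))"
proof -
  consider "Suc j = b \<or> j = b \<Longrightarrow> Suc i \<noteq> a \<and> i \<noteq> a \<and> i \<noteq> Suc a"
    | "Suc j = b" "Suc i = a" | "Suc j = b" "i = a" | "Suc j = b" "i = Suc a"
    | "j = b" "Suc i = a" | "j = b" "i = a" | "j = b" "i = Suc a"
    by blast
  then show ?thesis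
  proof cases
    case 1
    have "upper_slash a b s i j = s i j" "upper_slash a b s (Suc i) j = s (Suc i) j"
      "lower_slash a b s i (Suc j) = s i (Suc j)" "lower_slash a b s (Suc i) (Suc j) = s (Suc i) (Suc j)"
      using 1 by (auto simp: upper_slash_def lower_slash_def)
    then show ?thesis using parity_away_from_domino[OF assms 1] by simp
  next
    case 2
    then show ?thesis using parity_lower_left[of i j] by (auto simp: upper_slash_def lower_slash_def)
  next
    case 3
    then show ?thesis using parity_lower_middle[of j] by (auto simp: upper_slash_def lower_slash_def)
  next
    case 4
    then show ?thesis using parity_lower_right[of j] assms by (auto simp: upper_slash_def lower_slash_def)
  next
    case 5
    then show ?thesis using parity_upper_left[of i] assms by (auto simp: upper_slash_def lower_slash_def)
  next
    case 6
    then show ?thesis using parity_upper_middle assms by (auto simp: upper_slash_def lower_slash_def)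
  next
    case 7
    then show ?thesis using parity_upper_right assms by (auto simp: upper_slash_def lower_slash_def)
  qed
qed

end

section \<open>Construction of the 3-colouring\<close>

lemma colourable_if_parity:
  assumes a: "Suc a < m" and b: "b < n"
    and parity: "\<And>i j. \<lbrakk>Suc i < m; Suc j < n\<rbrakk> \<Longrightarrow>
      (upper_slash a b s i j = upper_slash a b s (Suc i) j) =
      (lower_slash a b s i (Suc j) = lower_slash a b s (Suc i) (Suc j))"
  shows "colourable 3 (grid_vertices m n) (domino_edges m n a b s)"
proof -
  txt \<open>
    \<open>dl j\<close> and \<open>h j i\<close> tell whether the colour, an integer modulo 3, increases or decreases by 1
    in a step up from row \<open>j\<close> and in a step right from column \<open>i\<close> in row \<open>j\<close>. The ends of a
    diagonal differ if the two steps agree for a slash and disagree for a backslash.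
  \<close>
  define lo where "lo = lower_slash a b s"
  define hi where "hi = upper_slash a b s"
  define sg :: "bool \<Rightarrow> int" where "sg p = (if p then 1 else - 1)" for p
  define dl where "dl = rec_nat True (\<lambda>j p. p = (lo 0 (Suc j) = hi 0 j))"
  define h where "h j i = (case j of 0 \<Rightarrow> lo i 0 | Suc j' \<Rightarrow> hi i j' = dl j')" for j i
  define X where "X j i = (\<Sum>k<i. sg (h j k))" for j i
  define Y where "Y j = (\<Sum>l<j. sg (dl l))" for j
  define Z where "Z = (\<lambda>(i, j). X j i + Y j)"
  have dl_simps: "dl 0 = True" "dl (Suc j) = (dl j = (lo 0 (Suc j) = hi 0 j))" for j
    by (auto simp: dl_def)
  \<comment> \<open>By \<open>parity\<close> this truth value passes unchanged from each column to
    the next; its value in column 0 drives the recursion for \<open>dl\<close>.\<close>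
  have row: "(lo i (Suc j) = hi i j) = (lo 0 (Suc j) = hi 0 j)" if "i < m" "Suc j < n" for i j
    using that(1)
  proof (induction i)
    case (Suc i)
    then show ?case
      using parity[of i j] that(2) by (auto simp: lo_def hi_def)
  qed simp
  \<comment> \<open>Row \<open>j\<close> is the upper side of the squares below it, from which
    \<open>h\<close> is defined. The recursion for \<open>dl\<close> makes the squares above it
    prescribe the same steps.\<close>
  have h_lo: "h j i = (lo i j = dl j)" if "i < m" "j < n" for i j
  proof (cases j)
    case (Suc j')
    then show ?thesis
      using row[of i j'] that by (auto simp: h_def dl_simps)
  qed (simp add: h_def dl_simps)
  have h_hi: "h (Suc j) i = (hi i j = dl j)" for i j
    by (simp add: h_def)
  have X_right: "X j (Suc i) = X j i + sg (h j i)" for i j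
    by (simp add: X_def)
  have Y_up: "Y (Suc j) = Y j + sg (dl j)" for j
    by (simp add: Y_def)
  \<comment> \<open>Outside the domino, both horizontal sides of a square carry the same step. In
    units of \<open>sg (dl b)\<close>, the steps along the domino are -1, 1 below and 1, -1 above,
    so \<open>Z\<close> differs by 3 between the midpoints, which share a colour.\<close>
  have X_up: "X (Suc j) i = X j i + (if j = b \<and> i = Suc a then 2 * sg (dl b) else 0)"
    if "i \<le> m" "j < n" for i j
    using that(1)
  proof (induction i)
    case 0
    then show ?case by (simp add: X_def)
  next
    case (Suc i)
    then show ?case
      using that(2) by (auto simp: X_right h_lo h_hi sg_def lo_def hi_def lower_slash_def upper_slash_def)
  qed
  have sg_cases: "sg p \<in> {1, - 1}" for p
    by (simp add: sg_def)
  have X_mid: "X b (Suc a) = X b a - sg (dl b)" "X b (Suc (Suc a)) = X b a"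
    using a b by (auto simp: X_right h_lo lo_def lower_slash_def sg_def)
  have arc: "Z q - Z p \<in> {1, - 1, 2, - 2}" if "domino_arc m n a b s p q" for p q
  proof -
    obtain i j k l where pq: "p = (i, j)" "q = (k, l)"
      by (metis surj_pair)
    consider (up) "k = i" "l = Suc j" "i \<le> m" "j < n" "\<not> (i = Suc a \<and> j = b)"
      | (right) "k = Suc i" "l = j" "i < m" "j \<le> n"
      | (slash) "k = Suc i" "l = Suc j" "i < m" "j < n" "s i j"
      | (backslash) "k = Suc i" "j = Suc l" "i < m" "l < n" "\<not> s i l"
      | (long) "i = a" "k = Suc (Suc a)" "j = b \<and> l = Suc b \<or> j = Suc b \<and> l = b"
      using \<open>domino_arc m n a b s p q\<close> unfolding pq domino_arc_def by (auto split: if_splits)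
    then show ?thesis
    proof cases
      case up
      then show ?thesis
        using sg_cases[of "dl j"] by (auto simp: pq Z_def X_up Y_up)
    next
      case right
      then show ?thesis
        using sg_cases[of "h j i"] by (auto simp: pq Z_def X_right)
    next
      case slash
      show ?thesis
      proof (cases "j = b \<and> i \<in> {a, Suc a}")
        case True
        then show ?thesis
          using slash a sg_cases[of "dl b"] by (auto simp: pq Z_def X_up Y_up X_mid)
      next
        case False
        \<comment> \<open>The step along the upper side equals the upward step, so the slash changes
          \<open>Z\<close> by 2 or -2.\<close>
        then have "h (Suc j) i = dl j"
          using slash by (auto simp: h_hi hi_def upper_slash_def)
        then show ?thesis
          using False slash sg_cases[of "dl j"] by (auto simp: pq Z_def X_up Y_up X_right)
      qed
    next
      case backslash
      show ?thesis
      proof (cases "l = b \<and> i \<in> {a, Suc a}")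
        case True
        then show ?thesis
          using backslash a sg_cases[of "dl b"] by (auto simp: pq Z_def X_up Y_up X_mid)
      next
        case False
        then have "h l i = (\<not> dl l)"
          using backslash by (simp add: h_lo lo_def lower_slash_def)
        then show ?thesis
          using False backslash by (auto simp: pq Z_def X_up Y_up X_right sg_def)
      qed
    next
      \<comment> \<open>The two ends of a long side have equal \<open>X\<close>, so only the upward
        step contributes.\<close>
      case long
      then show ?thesis
        using a b sg_cases[of "dl b"] by (auto simp: pq Z_def X_up Y_up X_mid)
    qed
  qed
  have arc_mod: "nat (Z p mod 3) \<noteq> nat (Z q mod 3)" if "domino_arc m n a b s p q" for p q
  proof
    assume "nat (Z p mod 3) = nat (Z q mod 3)"
    then have "Z q mod 3 = Z p mod 3"
      by (simp add: eq_nat_nat_iff)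
    then have "3 dvd Z q - Z p"
      by (simp add: mod_eq_dvd_iff)
    then show False
      using arc[OF that] by auto
  qed
  show ?thesis
    unfolding colourable_def
  proof (intro exI[of _ "\<lambda>p. nat (Z p mod 3)"] conjI ballI impI)
    show "nat (Z p mod 3) < 3" for p
      by (simp add: nat_less_iff)
    show "nat (Z p mod 3) \<noteq> nat (Z q mod 3)" if "{p, q} \<in> domino_edges m n a b s" for p q
      using that arc_mod[of p q] arc_mod[of q p] by (auto simp: domino_edges_iff)
  qed
qed

lemma domino_colourable_if_word_representable:
  assumes "Suc a < m" "b < n" "s (Suc a) b = s a b"
    and "word_representable (grid_vertices m n) (domino_edges m n a b s)"
  shows "colourable 3 (grid_vertices m n) (domino_edges m n a b s)"
  using assms parity by (intro colourable_if_parity) auto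

theorem theorem3:
  fixes m n :: nat and E :: "(nat \<times> nat) set set"
  assumes "m \<ge> 1" and "n \<ge> 1"
    and "single_domino_triangulation m n E"
  shows "word_representable (grid_vertices m n) E \<longleftrightarrow> colourable 3 (grid_vertices m n) E"
proof
  assume "colourable 3 (grid_vertices m n) E"
  then show "word_representable (grid_vertices m n) E"
    using colourable_3_imp_word_representable simple_graph_single_domino_triangulation assms(3)
    by blast
next
  assume wr: "word_representable (grid_vertices m n) E"
  obtain D e Fs F d where tile: "domino_tile m n D e Fs" and F: "F \<in> Fs"
    and d: "\<And>x. x \<in> unit_squares m n - D \<Longrightarrow> d x \<in> diagonals x"
    and E: "E = (grid_edges m n - {e}) \<union> d ` (unit_squares m n - D) \<union> F"
    using assms(3) unfolding single_domino_triangulation_def by metis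
  from tile show "colourable 3 (grid_vertices m n) E"
  proof cases
    case (horizontal a b)
    then have ab: "Suc a < m" "b < n"
      by (auto simp: unit_squares_def)
    from horizontal F d have F': "F \<in> horizontal_domino_triangulations a b"
      and d': "\<And>x. x \<in> unit_squares m n - {(a, b), (Suc a, b)} \<Longrightarrow> d x \<in> diagonals x"
      by simp_all
    from horizontal_domino_edges[OF ab F' d'] obtain s
      where "s (Suc a) b = s a b" "E = domino_edges m n a b s"
      unfolding E horizontal by auto
    then show ?thesis
      using domino_colourable_if_word_representable[OF ab] wr by simp
  next
    case (vertical a b)
    then have ab: "a < m" "Suc b < n"
      by (auto simp: unit_squares_def)
    from vertical F d have F': "F \<in> vertical_domino_triangulations a b"
      and d': "\<And>x. x \<in> unit_squares m n - {(a, b), (a, Suc b)} \<Longrightarrow> d x \<in> diagonals x"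
      by simp_all
    from vertical_domino_edges[OF ab F' d'] obtain s
      where s: "s (Suc b) a = s b a" and sE: "(`) prod.swap ` E = domino_edges n m b a s"
      unfolding E vertical by auto
    have sV: "prod.swap ` grid_vertices m n = grid_vertices n m"
      by (simp add: grid_vertices_def product_swap)
    \<comment> \<open>After reflection the domino is horizontal, with \<open>m\<close>,
      \<open>n\<close> and \<open>a\<close>, \<open>b\<close> exchanged; the colouring found there
      is then pulled back.\<close>
    have "word_representable (grid_vertices n m) (domino_edges n m b a s)"
      using word_representable_inj_image[OF inj_swap wr] unfolding sV sE .
    from domino_colourable_if_word_representable[OF ab(2,1) s this]
    show ?thesis
      using colourable_inj_image[of 3 prod.swap "grid_vertices m n" E] unfolding sV sE by blast
  qed
qed

end
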